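(* Let $r\ge 0$, $\rho\ge 0$, and let $E,K_1,K_2$ be nonnegative measurable functions on $(\mathbb{R}^+)^2$. Suppose that $$\lim_{t\to\infty}E(t+s,s)=0\quad\text{uniformly with respect to } s\in\mathbb{R}^+,$$ and that $\vartheta,\kappa$ are positive constants with $$\sup_{t\ge s\ge 0}E(t,s)\le\vartheta<\infty,\qquad \sup_{t\ge 0}\Big(\int_0^tK_1(t,s)\,ds+\int_t^\infty K_2(t,s)\,ds\Big)\le\kappa<\infty .$$ Let $\mathscr{L}_r(E;K_1,K_2;\rho)$ be the set of nonnegative functions $y\in C([-r,\infty))$ satisfying $$y(t)\le E(t,\tau)\|y_\tau\|+\int_\tau^tK_1(t,s)\|y_s\|\,ds+\int_t^\infty K_2(t,s)\|y_s\|\,ds+\rho,\qquad \forall\, t\ge\tau\ge 0.$$ (1) If $\kappa<1$, then for any $R,\varepsilon>0$ there exists $T>0$ such that $$\|y_t\|<\mu\rho+\varepsilon,\qquad t>T,$$ for all bounded functions $y\in\mathscr{L}_r(E;K_1,K_2;\rho)$ with $\|y_0\|\le R$, where $\mu=1/(1-\kappa)$. (2) If $\kappa<1/(1+\vartheta)$, then there exist $M,\lambda>0$ (independent of $\rho$) such that $$\|y_t\|\le M\|y_0\|e^{-\lambda t}+\gamma\rho,\qquad t\ge 0,$$ for all bounded functions $y\in\mathscr{L}_r(E;K_1,K_2;\rho)$, where $$\gamma=\frac{\mu+1}{1-\kappa c},\qquad c=\max\Big(\frac{\vartheta}{1-\kappa},\,1\Big),\qquad \mu=\frac1{1-\ka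ppa}.$$
   Context: $\mathbb{R}^+=[0,\infty)$. $\|\cdot\|$ is the sup-norm on $C([-r,0])$. For a continuous function $y$ on $[-r,\infty)$ and $t\ge 0$, the lift $y_t\in C([-r,0])$ is defined by $y_t(s)=y(t+s)$, $s\in[-r,0]$; thus $\|y_t\|=\sup_{s\in[-r,0]}|y(t+s)|$. *)

theory Defs
  imports "HOL-Analysis.Analysis"
begin

text \<open>
  Functions on \<open>[-r,\<infinity>)\<close> and on the quarter plane are represented by total functions on the reals;
  only their values on the stated domain matter.
\<close>

definition lift :: "(real \<Rightarrow> real) \<Rightarrow> real \<Rightarrow> (real \<Rightarrow> real)" where
  "lift y t = (\<lambda>s. y (t + s))"

text \<open>
  The sup-norm of \<open>C([-r,0])\<close>. The supremum is a real one, hence meaningful only for functions that are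
  bounded on \<open>[-r,0]\<close> (with \<open>r \<ge> 0\<close>), in particular for continuous ones.
\<close>

definition sup_norm :: "real \<Rightarrow> (real \<Rightarrow> real) \<Rightarrow> real" where
  "sup_norm r \<phi> = (SUP s\<in>{-r..0}. \<bar>\<phi> s\<bar>)"

definition nonneg_measurable_quadrant :: "(real \<Rightarrow> real \<Rightarrow> real) \<Rightarrow> bool" where
  "nonneg_measurable_quadrant F \<longleftrightarrow>
     (\<lambda>(t, s). F t s) \<in> borel_measurable (lebesgue_on ({0..} \<times> {0..})) \<and>
     (\<forall>t\<ge>0. \<forall>s\<ge>0. 0 \<le> F t s)"

text \<open>
  The inequality is stated in \<^typ>\<open>ennreal\<close>: all terms are nonnegative, and for unbounded \<open>y\<close> the
  integrals may be infinite, in which case the inequality holds trivially. A Lebesgue measurable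
  kernel may have exceptional non-measurable sections, on which the integral below is the lower integral.
\<close>

definition integral_ineq_class ::
  "real \<Rightarrow> (real \<Rightarrow> real \<Rightarrow> real) \<Rightarrow> (real \<Rightarrow> real \<Rightarrow> real) \<Rightarrow> (real \<Rightarrow> real \<Rightarrow> real) \<Rightarrow> real
    \<Rightarrow> (real \<Rightarrow> real) set" where
  "integral_ineq_class r E K1 K2 \<rho> =
     {y. continuous_on {-r..} y \<and> (\<forall>t\<ge>-r. 0 \<le> y t) \<and>
         (\<forall>\<tau> t. 0 \<le> \<tau> \<and> \<tau> \<le> t \<longrightarrow>
            ennreal (y t) \<le> ennreal (E t \<tau> * sup_norm r (lift y \<tau>))
              + (\<integral>\<^sup>+ s\<in>{\<tau>..t}. ennreal (K1 t s * sup_norm r (lift y s)) \<partial>lebesgue)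
              + (\<integral>\<^sup>+ s\<in>{t..}. ennreal (K2 t s * sup_norm r (lift y s)) \<partial>lebesgue)
              + ennreal \<rho>)}"

end

theory Submission
  imports Defs
begin

text \<open>
  If \<open>\<parallel>y\<^sub>s\<parallel> \<le> N\<close> for all \<open>s \<ge> \<tau>\<close>, the integral inequality collapses to
  \<open>y(t) \<le> E(t,\<tau>) \<parallel>y\<^sub>\<tau>\<parallel> + \<kappa> N + \<rho>\<close>. Bounding \<open>E\<close> by \<open>\<theta>\<close> and absorbing \<open>\<kappa> N\<close> gives the a priori bound
  \<open>\<parallel>y\<^sub>t\<parallel> \<le> c \<parallel>y\<^sub>\<tau>\<parallel> + \<mu> \<rho>\<close> for \<open>t \<ge> \<tau>\<close>. Waiting long enough for \<open>E\<close> to be at most \<open>\<delta>\<close>, uniformly in \<open>\<tau>\<close>, turns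
  a bound \<open>B\<close> that is valid from \<open>\<tau>\<close> on into \<open>\<kappa> B + \<rho> + \<delta>'\<close>; iterating this yields part (1).
  For part (2), combining both bounds gives \<open>\<parallel>y\<^sub>t\<parallel> \<le> (\<kappa> c + \<delta>) \<parallel>y\<^sub>\<tau>\<parallel> + \<mu> \<rho>\<close> for \<open>t \<ge> \<tau> + T\<close>, where
  \<open>\<kappa> c < 1\<close> because \<open>\<kappa> (1 + \<theta>) < 1\<close>, and the iteration of this bound is a geometric decay.
\<close>

section \<open>Lower integrals of a kernel times a bounded factor\<close>

text \<open>The kernels may have non-measurable sections, to which the library's \<open>nn_integral_cmult\<close> does not apply.\<close>

lemma nn_integral_cmult_le:
  fixes N :: real
  assumes "0 \<le> N"
  shows "(\<integral>\<^sup>+ x. ennreal N * f x \<partial>M) \<le> ennreal N * (\<integral>\<^sup>+ x. f x \<partial>M)"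
proof (cases "N = 0")
  case False
  with assms have N: "N > 0" by simp
  have inv: "ennreal N * (ennreal (1 / N) * z) = z" "ennreal (1 / N) * (ennreal N * z) = z" for z
    using N by (simp_all add: mult.assoc[symmetric] ennreal_mult[symmetric])
  show ?thesis
    \<comment> \<open>Dividing a simple minorant of \<open>N * f\<close> by \<open>N\<close> gives a
      simple minorant of \<open>f\<close>, so measurability of \<open>f\<close> is never called
      upon.\<close>
    unfolding nn_integral_def[of M "\<lambda>x. ennreal N * f x"]
  proof (rule SUP_least)
    fix g assume "g \<in> {g. simple_function M g \<and> g \<le> (\<lambda>x. ennreal N * f x)}"
    then have g: "simple_function M g" "\<And>x. g x \<le> ennreal N * f x"
      by (auto simp: le_fun_def)
    have h: "simple_function M (\<lambda>x. ennreal (1 / N) * g x)"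
      using g(1) by (rule simple_function_compose1)
    have "integral\<^sup>S M g = integral\<^sup>S M (\<lambda>x. ennreal N * (ennreal (1 / N) * g x))"
      by (simp add: inv)
    also have "\<dots> = ennreal N * integral\<^sup>S M (\<lambda>x. ennreal (1 / N) * g x)"
      by (rule simple_integral_mult[OF h])
    also have "\<dots> = ennreal N * (\<integral>\<^sup>+ x. ennreal (1 / N) * g x \<partial>M)"
      by (simp add: nn_integral_eq_simple_integral[OF h])
    also have "\<dots> \<le> ennreal N * (\<integral>\<^sup>+ x. f x \<partial>M)"
    proof (intro mult_left_mono nn_integral_mono)
      fix x
      have "ennreal (1 / N) * g x \<le> ennreal (1 / N) * (ennreal N * f x)"
        by (intro mult_left_mono g(2)) simp
      then show "ennreal (1 / N) * g x \<le> f x" by (simp add: inv)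
    qed simp
    finally show "integral\<^sup>S M g \<le> ennreal N * (\<integral>\<^sup>+ x. f x \<partial>M)" .
  qed
qed simp

text \<open>Besides extracting \<open>N\<close>, this enlarges the domain: the hypothesis on
  \<open>K1\<close> controls the integral over \<open>{0..t}\<close>, while the inequality
  integrates over \<open>{\<tau>..t}\<close>.\<close>

lemma set_nn_integral_mult_le:
  fixes k n :: "real \<Rightarrow> real"
  assumes "A \<subseteq> B" "0 \<le> N"
    and "\<And>s. s \<in> A \<Longrightarrow> 0 \<le> k s" "\<And>s. s \<in> A \<Longrightarrow> n s \<le> N"
  shows "(\<integral>\<^sup>+ s\<in>A. ennreal (k s * n s) \<partial>M) \<le> ennreal N * (\<integral>\<^sup>+ s\<in>B. ennreal (k s) \<partial>M)"
proof -
  have "(\<integral>\<^sup>+ s\<in>A. ennreal (k s * n s) \<partial>M) \<le> (\<integral>\<^sup>+ s. ennreal N * (ennreal (k s) * indicator B s) \<partial>M)"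
  proof (rule nn_integral_mono)
    fix s
    show "ennreal (k s * n s) * indicator A s \<le> ennreal N * (ennreal (k s) * indicator B s)"
    proof (cases "s \<in> A")
      case True
      then have "k s * n s \<le> N * k s"
        using assms(3,4) by (metis mult.commute mult_left_mono)
      then show ?thesis
        using True assms(1,2) by (auto simp: ennreal_mult'[symmetric] intro!: ennreal_leI)
    qed simp
  qed
  also have "\<dots> \<le> ennreal N * (\<integral>\<^sup>+ s\<in>B. ennreal (k s) \<partial>M)"
    by (rule nn_integral_cmult_le[OF assms(2)])
  finally show ?thesis .
qed

section \<open>Sup-norm of a lift versus pointwise bounds\<close>

lemma sup_norm_lift_le:
  assumes "0 \<le> r" "\<And>u. t - r \<le> u \<Longrightarrow> u \<le> t \<Longrightarrow> \<bar>y u\<bar> \<le> B"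
  shows "sup_norm r (lift y t) \<le> B"
  unfolding sup_norm_def lift_def using assms by (intro cSUP_least) auto

lemma le_sup_norm_lift:
  assumes "bounded (y ` {-r..})" "0 \<le> t" "t - r \<le> u" "u \<le> t"
  shows "\<bar>y u\<bar> \<le> sup_norm r (lift y t)"
proof -
  obtain B where B: "\<And>x. x \<ge> -r \<Longrightarrow> \<bar>y x\<bar> \<le> B"
    using assms(1) by (auto simp: bounded_iff)
  have "bdd_above ((\<lambda>s. \<bar>y (t + s)\<bar>) ` {-r..0})"
    using assms(2) B by (intro bdd_aboveI2[where M = B]) auto
  then have "\<bar>y (t + (u - t))\<bar> \<le> (SUP s\<in>{-r..0}. \<bar>y (t + s)\<bar>)"
    using assms(3,4) by (intro cSUP_upper) auto
  then show ?thesis by (simp add: sup_norm_def lift_def)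
qed

section \<open>Estimates for a single bounded solution\<close>

text \<open>What remains of the integral inequality for a bounded solution once \<open>\<parallel>y\<^sub>s\<parallel>\<close> is estimated by a constant.\<close>

locale bounded_solution =
  fixes r \<theta> \<kappa> \<rho> :: real and E :: "real \<Rightarrow> real \<Rightarrow> real" and y :: "real \<Rightarrow> real"
  assumes r: "0 \<le> r" and \<kappa>: "0 \<le> \<kappa>" "\<kappa> < 1" and \<rho>: "0 \<le> \<rho>"
    and nonneg: "t \<ge> -r \<Longrightarrow> 0 \<le> y t"
    and bounded: "bounded (y ` {-r..})"
    and E_le: "0 \<le> s \<Longrightarrow> s \<le> t \<Longrightarrow> E t s \<le> \<theta>"
    and integral_step: "0 \<le> \<tau> \<Longrightarrow> \<tau> \<le> t \<Longrightarrow> (\<And>s. \<tau> \<le> s \<Longrightarrow> sup_norm r (lift y s) \<le> N)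
      \<Longrightarrow> y t \<le> E t \<tau> * sup_norm r (lift y \<tau>) + \<kappa> * N + \<rho>"
begin

definition \<mu> :: real where "\<mu> = 1 / (1 - \<kappa>)"

text \<open>The first entry comes from solving
  \<open>N \<le> \<theta> * n + \<kappa> * N + \<rho>\<close> for \<open>N\<close>; the entry 1
  covers the case \<open>N \<le> n\<close>, with the supremum attained before the starting
  time.\<close>

definition c :: real where "c = max (\<theta> / (1 - \<kappa>)) 1"

abbreviation nrm :: "real \<Rightarrow> real" where "nrm t \<equiv> sup_norm r (lift y t)"

lemma nrm_leI:
  assumes "0 \<le> t" "\<And>u. t - r \<le> u \<Longrightarrow> u \<le> t \<Longrightarrow> y u \<le> B"
  shows "nrm t \<le> B"
  using assms r nonneg by (intro sup_norm_lift_le) auto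

lemma le_nrm: "0 \<le> t \<Longrightarrow> t - r \<le> u \<Longrightarrow> u \<le> t \<Longrightarrow> y u \<le> nrm t"
  using le_sup_norm_lift[OF bounded, of t u] by simp

lemma nrm_nonneg: "0 \<le> t \<Longrightarrow> 0 \<le> nrm t"
  using le_nrm[of t t] nonneg[of t] r by simp

lemma mu_pos: "0 < \<mu>"
  using \<kappa> by (simp add: \<mu>_def)

text \<open>\<open>\<mu>\<close> is the fixed point of \<open>x \<mapsto> \<kappa> * x + 1\<close>,
  so an additive term \<open>\<mu> * \<rho>\<close> reproduces itself under a step that multiplies
  by \<open>\<kappa>\<close> and adds \<open>\<rho>\<close>.\<close>

lemma mu_eq: "\<kappa> * \<mu> + 1 = \<mu>"
  using \<kappa> by (simp add: \<mu>_def field_simps)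

lemma c_ge_1: "1 \<le> c"
  by (simp add: c_def)

lemma a_priori_bound:
  assumes "0 \<le> \<tau>" "\<tau> \<le> t"
  shows "nrm t \<le> c * nrm \<tau> + \<mu> * \<rho>"
proof -
  obtain B where B: "\<And>x. x \<ge> -r \<Longrightarrow> \<bar>y x\<bar> \<le> B"
    using bounded by (auto simp: bounded_iff)
  \<comment> \<open>Boundedness of \<open>y\<close> makes this supremum finite, which is what allows
    \<open>\<kappa> * N\<close> to be moved to the left side.\<close>
  define N where "N = (SUP u\<in>{\<tau>-r..}. y u)"
  have bdd: "bdd_above (y ` {\<tau>-r..})"
    using assms(1) B by (intro bdd_aboveI2[where M = B]) (smt (verit) atLeast_iff)
  have yN: "y u \<le> N" if "u \<ge> \<tau> - r" for u
    unfolding N_def using that by (intro cSUP_upper bdd) auto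
  have nN: "nrm s \<le> N" if "\<tau> \<le> s" for s
    using that assms(1) by (intro nrm_leI yN) auto
  have n0: "0 \<le> nrm \<tau>"
    by (rule nrm_nonneg[OF assms(1)])
  have "N \<le> max (nrm \<tau>) (\<theta> * nrm \<tau> + \<kappa> * N + \<rho>)"
    unfolding N_def
  proof (rule cSUP_least, simp, fold N_def)
    fix u assume u: "u \<in> {\<tau>-r..}"
    show "y u \<le> max (nrm \<tau>) (\<theta> * nrm \<tau> + \<kappa> * N + \<rho>)"
    \<comment> \<open>Times up to \<open>\<tau>\<close> lie in the window measured by
      \<open>nrm \<tau>\<close>; only later times need the inequality.\<close>
    proof (cases "u \<le> \<tau>")
      case True
      then show ?thesis using le_nrm[of \<tau> u] u assms(1) by auto
    next
      case False
      then have "y u \<le> E u \<tau> * nrm \<tau> + \<kappa> * N + \<rho>"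
        using assms(1) nN by (intro integral_step) auto
      also have "\<dots> \<le> \<theta> * nrm \<tau> + \<kappa> * N + \<rho>"
        using E_le[of \<tau> u] False assms(1) n0 by (simp add: mult_right_mono)
      finally show ?thesis by simp
    qed
  qed
  then consider "N \<le> nrm \<tau>" | "N \<le> \<theta> * nrm \<tau> + \<kappa> * N + \<rho>" by linarith
  then have "N \<le> c * nrm \<tau> + \<mu> * \<rho>"
  proof cases
    case 1
    moreover have "1 * nrm \<tau> \<le> c * nrm \<tau>"
      using n0 c_ge_1 by (intro mult_right_mono) auto
    moreover have "0 \<le> \<mu> * \<rho>"
      using mu_pos \<rho> by simp
    ultimately show ?thesis by simp
  next
    case 2
    then have "(1 - \<kappa>) * N \<le> \<theta> * nrm \<tau> + \<rho>" by (simp add: algebra_simps)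
    then have "N \<le> (\<theta> * nrm \<tau> + \<rho>) / (1 - \<kappa>)"
      using \<kappa> by (simp add: field_simps)
    also have "\<dots> = \<theta> / (1 - \<kappa>) * nrm \<tau> + \<mu> * \<rho>"
      by (simp add: \<mu>_def add_divide_distrib)
    also have "\<dots> \<le> c * nrm \<tau> + \<mu> * \<rho>"
      using n0 by (intro add_right_mono mult_right_mono) (auto simp: c_def)
    finally show ?thesis .
  qed
  with nN[OF assms(2)] show ?thesis by simp
qed

text \<open>The extra delay \<open>r\<close> keeps the whole window \<open>{t-r..t}\<close> at
  distance at least \<open>S\<close> from \<open>\<tau>\<close>, so \<open>E\<close> is small at
  every point of it.\<close>

lemma delayed_step:
  assumes "0 \<le> \<tau>" "\<tau> + S + r \<le> t" "0 \<le> S"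
    and "\<And>u s. S \<le> u \<Longrightarrow> 0 \<le> s \<Longrightarrow> E (u + s) s \<le> \<delta>"
    and "\<And>s. \<tau> \<le> s \<Longrightarrow> nrm s \<le> N"
  shows "nrm t \<le> \<delta> * nrm \<tau> + \<kappa> * N + \<rho>"
proof (rule nrm_leI)
  show "0 \<le> t" using assms r by simp
  fix u assume u: "t - r \<le> u" "u \<le> t"
  have "y u \<le> E u \<tau> * nrm \<tau> + \<kappa> * N + \<rho>"
    using assms u by (intro integral_step) auto
  moreover have "E u \<tau> * nrm \<tau> \<le> \<delta> * nrm \<tau>"
    using assms(4)[of "u - \<tau>" \<tau>] assms(1,2) u nrm_nonneg[of \<tau>] by (intro mult_right_mono) auto
  ultimately show "y u \<le> \<delta> * nrm \<tau> + \<kappa> * N + \<rho>" by simp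
qed

text \<open>Each block of length \<open>S + r\<close> multiplies the current bound by
  \<open>\<kappa>\<close> and adds \<open>\<rho> + \<delta> * B\<close>, the \<open>E\<close> term
  being estimated by the initial \<open>B\<close> throughout. The additions form a geometric series
  with sum at most \<open>\<mu> * (\<rho> + \<delta> * B)\<close>.\<close>

lemma iterated_bound:
  assumes "0 \<le> S" "0 \<le> \<delta>" "0 \<le> B"
    and "\<And>u s. S \<le> u \<Longrightarrow> 0 \<le> s \<Longrightarrow> E (u + s) s \<le> \<delta>"
    and "\<And>s. 0 \<le> s \<Longrightarrow> nrm s \<le> B"
    and "real n * (S + r) \<le> t"
  shows "nrm t \<le> \<kappa> ^ n * B + \<mu> * (\<rho> + \<delta> * B)"
  using assms(6)
proof (induction n arbitrary: t)
  case 0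
  have "0 \<le> \<mu> * (\<rho> + \<delta> * B)"
    using mu_pos \<rho> assms(2,3) by simp
  then show ?case using assms(5)[of t] 0 by simp
next
  case (Suc n)
  let ?\<tau> = "real n * (S + r)"
  have \<tau>: "0 \<le> ?\<tau>" using assms(1) r by simp
  have "nrm t \<le> \<delta> * nrm ?\<tau> + \<kappa> * (\<kappa> ^ n * B + \<mu> * (\<rho> + \<delta> * B)) + \<rho>"
    using Suc assms(1,4) \<tau> by (intro delayed_step) (auto simp: algebra_simps)
  also have "\<dots> \<le> \<delta> * B + \<kappa> * (\<kappa> ^ n * B + \<mu> * (\<rho> + \<delta> * B)) + \<rho>"
    using assms(2) assms(5)[OF \<tau>] by (simp add: mult_left_mono)
  also have "\<dots> = \<kappa> ^ Suc n * B + (\<kappa> * \<mu> + 1) * (\<rho> + \<delta> * B)"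
    by (simp add: algebra_simps)
  finally show ?case unfolding mu_eq .
qed

text \<open>The a priori bound from \<open>\<tau>\<close> on serves as the constant \<open>N\<close>
  of the delayed step, so the new bound involves \<open>nrm \<tau>\<close> alone.\<close>

lemma contraction_step:
  assumes "0 \<le> \<tau>" "\<tau> + S + r \<le> t" "0 \<le> S"
    and "\<And>u s. S \<le> u \<Longrightarrow> 0 \<le> s \<Longrightarrow> E (u + s) s \<le> \<delta>"
  shows "nrm t \<le> (\<kappa> * c + \<delta>) * nrm \<tau> + \<mu> * \<rho>"
proof -
  have "nrm t \<le> \<delta> * nrm \<tau> + \<kappa> * (c * nrm \<tau> + \<mu> * \<rho>) + \<rho>"
    using assms by (intro delayed_step a_priori_bound)
  also have "\<dots> = (\<kappa> * c + \<delta>) * nrm \<tau> + (\<kappa> * \<mu> + 1) * \<rho>"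
    by (simp add: algebra_simps)
  finally show ?thesis unfolding mu_eq .
qed

text \<open>The offset \<open>u\<close> stands for the remainder of a time modulo the block length,
  so that every time is reached.\<close>

lemma geometric_decay:
  assumes "0 \<le> S" "0 \<le> u" "0 \<le> \<delta>" "\<kappa> * c + \<delta> < 1"
    and "\<And>u s. S \<le> u \<Longrightarrow> 0 \<le> s \<Longrightarrow> E (u + s) s \<le> \<delta>"
  shows "nrm (u + real n * (S + r))
    \<le> (\<kappa> * c + \<delta>) ^ n * (c * nrm 0) + \<mu> * \<rho> / (1 - (\<kappa> * c + \<delta>))"
proof (induction n)
  case 0
  let ?q = "\<kappa> * c + \<delta>"
  have "0 \<le> ?q" using \<kappa> c_ge_1 assms(3) by simp
  then have "\<mu> * \<rho> / 1 \<le> \<mu> * \<rho> / (1 - ?q)"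
    using mu_pos \<rho> assms(4) by (intro divide_left_mono) auto
  then show ?case using a_priori_bound[of 0 u] assms(2) by simp
next
  case (Suc n)
  let ?q = "\<kappa> * c + \<delta>"
  have q: "0 \<le> ?q" using \<kappa> c_ge_1 assms(3) by simp
  have "nrm (u + real (Suc n) * (S + r)) \<le> ?q * nrm (u + real n * (S + r)) + \<mu> * \<rho>"
    using assms r by (intro contraction_step[of _ S]) (auto simp: algebra_simps)
  also have "\<dots> \<le> ?q * (?q ^ n * (c * nrm 0) + \<mu> * \<rho> / (1 - ?q)) + \<mu> * \<rho>"
    using q by (intro add_right_mono mult_left_mono Suc)
  also have "\<dots> = ?q ^ Suc n * (c * nrm 0) + (?q * (\<mu> * \<rho> / (1 - ?q)) + \<mu> * \<rho>)"
    by (simp only: distrib_left power_Suc mult.assoc add.assoc)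
  \<comment> \<open>The additive term is the fixed point of the affine map being iterated.\<close>
  also have "?q * (\<mu> * \<rho> / (1 - ?q)) + \<mu> * \<rho> = \<mu> * \<rho> / (1 - ?q)"
  proof -
    have "q * (b / (1 - q)) + b = b / (1 - q)" if "q < 1" for q b :: real
      using that by (simp add: field_simps)
    then show ?thesis using assms(4) .
  qed
  finally show ?case .
qed

end

section \<open>From discrete to exponential decay, and the theorem\<close>

text \<open>Rounding down loses less than one block, and the factor \<open>1 / q\<close> pays for
  it.\<close>

lemma power_nat_floor_le:
  fixes q T t :: real
  assumes "0 < q" "q < 1" "0 < T" "0 \<le> t"
  shows "q ^ nat \<lfloor>t / T\<rfloor> \<le> exp (- (- ln q / T) * t) / q"
proof -
  define n where "n = nat \<lfloor>t / T\<rfloor>"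
  have "t / T < real n + 1" using assms unfolding n_def by linarith
  then have "(real n + 1) * ln q \<le> t / T * ln q"
    using assms by (intro mult_right_mono_neg) auto
  then have "exp ((real n + 1) * ln q) \<le> exp (- (- ln q / T) * t)"
    by (simp add: mult.commute)
  moreover have "exp ((real n + 1) * ln q) = q ^ n * q"
    using assms(1) by (simp add: distrib_right exp_add exp_of_nat_mult)
  ultimately have "q ^ n * q \<le> exp (- (- ln q / T) * t)"
    by simp
  then show ?thesis
    unfolding n_def[symmetric] using assms(1) by (subst pos_le_divide_eq)
qed

theorem theorem1p1:
  fixes r \<theta> \<kappa> :: real and E K1 K2 :: "real \<Rightarrow> real \<Rightarrow> real"
  assumes "0 \<le> r"
    and "nonneg_measurable_quadrant E"
    and "nonneg_measurable_quadrant K1"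
    and "nonneg_measurable_quadrant K2"
    and "uniform_limit {0..} (\<lambda>t s. E (t + s) s) (\<lambda>s. 0) at_top"
    and "0 < \<theta>" and "0 < \<kappa>"
    and "(SUP (t, s)\<in>{(t, s). 0 \<le> s \<and> s \<le> t}. ennreal (E t s)) \<le> ennreal \<theta>"
    and "(SUP t\<in>{0..}. (\<integral>\<^sup>+ s\<in>{0..t}. ennreal (K1 t s) \<partial>lebesgue)
                     + (\<integral>\<^sup>+ s\<in>{t..}. ennreal (K2 t s) \<partial>lebesgue)) \<le> ennreal \<kappa>"
  shows
    "let \<mu> = 1 / (1 - \<kappa>);
         c = max (\<theta> / (1 - \<kappa>)) 1;
         \<gamma> = (\<mu> + 1) / (1 - \<kappa> * c)
     in (\<kappa> < 1 \<longrightarrow>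
           (\<forall>\<rho>\<ge>0. \<forall>R>0. \<forall>\<epsilon>>0. \<exists>T>0. \<forall>y \<in> integral_ineq_class r E K1 K2 \<rho>.
              bounded (y ` {-r..}) \<and> sup_norm r (lift y 0) \<le> R \<longrightarrow>
              (\<forall>t>T. sup_norm r (lift y t) < \<mu> * \<rho> + \<epsilon>))) \<and>
        (\<kappa> < 1 / (1 + \<theta>) \<longrightarrow>
           (\<exists>M>0. \<exists>l>0. \<forall>\<rho>\<ge>0. \<forall>y \<in> integral_ineq_class r E K1 K2 \<rho>.
              bounded (y ` {-r..}) \<longrightarrow>
              (\<forall>t\<ge>0. sup_norm r (lift y t) \<le> M * sup_norm r (lift y 0) * exp (- l * t) + \<gamma> * \<rho>)))"
proof -
  have E_bound: "E t s \<le> \<theta>" if "0 \<le> s" "s \<le> t" for t s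
  proof -
    have "(case (t, s) of (t, s) \<Rightarrow> ennreal (E t s))
        \<le> (SUP (t, s)\<in>{(t, s). 0 \<le> s \<and> s \<le> t}. ennreal (E t s))"
      using that by (intro SUP_upper) auto
    then have "ennreal (E t s) \<le> ennreal \<theta>"
      using assms(8) by simp
    then show ?thesis using \<open>0 < \<theta>\<close> by (simp add: ennreal_le_iff)
  qed
  \<comment> \<open>Requiring \<open>S \<ge> 1\<close> keeps the block length \<open>S + r\<close>
    positive even for \<open>r = 0\<close>.\<close>
  have E_small: "\<exists>S\<ge>1. \<forall>u s. S \<le> u \<longrightarrow> 0 \<le> s \<longrightarrow> E (u + s) s \<le> \<delta>" if "0 < \<delta>" for \<delta>
  proof -
    from uniform_limitD[OF assms(5) that] obtain S where
      S: "\<And>u s. S \<le> u \<Longrightarrow> 0 \<le> s \<Longrightarrow> dist (E (u + s) s) 0 < \<delta>"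
      unfolding eventually_at_top_linorder by auto
    have "E (u + s) s \<le> \<delta>" if "max 1 S \<le> u" "0 \<le> s" for u s
      using S[of u s] that by (simp add: dist_real_def)
    then show ?thesis by (intro exI[of _ "max 1 S"]) auto
  qed
  have solution: "bounded_solution r \<theta> \<kappa> \<rho> E y"
    if "\<kappa> < 1" "0 \<le> \<rho>" and y: "y \<in> integral_ineq_class r E K1 K2 \<rho>" and bdd: "bounded (y ` {-r..})"
    for \<rho> y
  proof
    fix \<tau> t N :: real
    assume \<tau>: "0 \<le> \<tau>" "\<tau> \<le> t" and N: "\<And>s. \<tau> \<le> s \<Longrightarrow> sup_norm r (lift y s) \<le> N"
    have "0 \<le> sup_norm r (lift y \<tau>)"
      using le_sup_norm_lift[OF bdd, of \<tau> \<tau>] \<tau> assms(1) by simp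
    moreover from this have N0: "0 \<le> N" using N[of \<tau>] by simp
    moreover have "0 \<le> E t \<tau>" using assms(2) \<tau> by (simp add: nonneg_measurable_quadrant_def)
    ultimately have nn: "0 \<le> E t \<tau> * sup_norm r (lift y \<tau>)" by simp
    have K: "(\<integral>\<^sup>+ s\<in>{0..t}. ennreal (K1 t s) \<partial>lebesgue) + (\<integral>\<^sup>+ s\<in>{t..}. ennreal (K2 t s) \<partial>lebesgue)
        \<le> ennreal \<kappa>" (is "?I1 + ?I2 \<le> _")
      using \<tau> by (intro order_trans[OF SUP_upper assms(9)]) simp
    have "ennreal (y t) \<le> ennreal (E t \<tau> * sup_norm r (lift y \<tau>))
        + (\<integral>\<^sup>+ s\<in>{\<tau>..t}. ennreal (K1 t s * sup_norm r (lift y s)) \<partial>lebesgue)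
        + (\<integral>\<^sup>+ s\<in>{t..}. ennreal (K2 t s * sup_norm r (lift y s)) \<partial>lebesgue) + ennreal \<rho>"
      using y \<tau> by (simp add: integral_ineq_class_def)
    also have "\<dots> \<le> ennreal (E t \<tau> * sup_norm r (lift y \<tau>)) + ennreal N * ?I1 + ennreal N * ?I2 + ennreal \<rho>"
      using assms(3,4) \<tau> N N0
      by (intro add_mono order_refl set_nn_integral_mult_le) (auto simp: nonneg_measurable_quadrant_def)
    also have "\<dots> = ennreal (E t \<tau> * sup_norm r (lift y \<tau>)) + ennreal N * (?I1 + ?I2) + ennreal \<rho>"
      by (simp add: distrib_left add.assoc)
    also have "\<dots> \<le> ennreal (E t \<tau> * sup_norm r (lift y \<tau>)) + ennreal N * ennreal \<kappa> + ennreal \<rho>"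
      by (intro add_mono order_refl mult_left_mono K) simp
    also have "\<dots> = ennreal (E t \<tau> * sup_norm r (lift y \<tau>) + \<kappa> * N + \<rho>)"
      using nn N0 that(2) \<open>0 < \<kappa>\<close>
      by (simp add: ennreal_mult[symmetric] ennreal_plus[symmetric] mult.commute del: ennreal_plus)
    \<comment> \<open>The right side is now finite and nonnegative, so the inequality descends from
      \<open>ennreal\<close> to the reals.\<close>
    finally show "y t \<le> E t \<tau> * sup_norm r (lift y \<tau>) + \<kappa> * N + \<rho>"
      using nn N0 that(2) \<open>0 < \<kappa>\<close> by (subst (asm) ennreal_le_iff) auto
  qed (use assms that E_bound in \<open>auto simp: integral_ineq_class_def\<close>)

  define \<mu> where "\<mu> = 1 / (1 - \<kappa>)"
  define c where "c = max (\<theta> / (1 - \<kappa>)) 1"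
  have c1: "1 \<le> c" by (simp add: c_def)

  have part1: "\<exists>T>0. \<forall>y \<in> integral_ineq_class r E K1 K2 \<rho>.
      bounded (y ` {-r..}) \<and> sup_norm r (lift y 0) \<le> R \<longrightarrow>
      (\<forall>t>T. sup_norm r (lift y t) < \<mu> * \<rho> + \<epsilon>)"
    if "\<kappa> < 1" "0 \<le> \<rho>" "0 < R" "0 < \<epsilon>" for \<rho> R \<epsilon>
  proof -
    have \<mu>: "0 < \<mu>" using that by (simp add: \<mu>_def)
    \<comment> \<open>The a priori bound from time 0, common to all solutions in question; hence
      \<open>\<delta>\<close>, \<open>S\<close> and \<open>n\<close> below do not depend on
      \<open>y\<close>.\<close>
    define B where "B = c * R + \<mu> * \<rho>"
    have B: "0 < B" unfolding B_def using c1 \<mu> that by (intro add_pos_nonneg mult_pos_pos) auto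
    \<comment> \<open>Half of \<open>\<epsilon>\<close> goes to the accumulated \<open>E\<close>
      terms, the other half to \<open>\<kappa> ^ n * B\<close>.\<close>
    define \<delta> where "\<delta> = \<epsilon> / (2 * \<mu> * B)"
    have \<delta>: "0 < \<delta>" "\<mu> * (\<delta> * B) = \<epsilon> / 2" using \<mu> B that by (simp_all add: \<delta>_def)
    obtain S where S: "1 \<le> S" "\<And>u s. S \<le> u \<Longrightarrow> 0 \<le> s \<Longrightarrow> E (u + s) s \<le> \<delta>"
      using E_small[OF \<delta>(1)] by blast
    obtain n where "\<kappa> ^ n < \<epsilon> / (2 * B)"
      using real_arch_pow_inv[OF divide_pos_pos[OF \<open>0 < \<epsilon>\<close>] \<open>\<kappa> < 1\<close>, of "2 * B"] B by auto
    then have n: "\<kappa> ^ n * B < \<epsilon> / 2" using B by (simp add: field_simps)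
    show ?thesis
    proof (intro exI[of _ "real n * (S + r) + 1"] conjI ballI impI allI)
      show "0 < real n * (S + r) + 1" using S(1) assms(1) by (intro add_nonneg_pos) auto
      fix y t
      assume "y \<in> integral_ineq_class r E K1 K2 \<rho>" "bounded (y ` {-r..}) \<and> sup_norm r (lift y 0) \<le> R"
        and t: "real n * (S + r) + 1 < t"
      then have y: "y \<in> integral_ineq_class r E K1 K2 \<rho>" "bounded (y ` {-r..})" "sup_norm r (lift y 0) \<le> R"
        by blast+
      interpret bounded_solution r \<theta> \<kappa> \<rho> E y
        rewrites "bounded_solution.\<mu> \<kappa> = \<mu>" and "bounded_solution.c \<theta> \<kappa> = c"
        using solution[OF that(1,2) y(1,2)]
        by (simp_all add: bounded_solution.\<mu>_def bounded_solution.c_def \<mu>_def c_def)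
      have "nrm s \<le> B" if "0 \<le> s" for s
      proof -
        have "c * nrm 0 \<le> c * R" using y(3) c1 by (intro mult_left_mono) auto
        then show ?thesis using a_priori_bound[of 0 s] that by (simp add: B_def)
      qed
      then have "nrm t \<le> \<kappa> ^ n * B + \<mu> * (\<rho> + \<delta> * B)"
        using S \<delta>(1) B t by (intro iterated_bound[of S]) auto
      also have "\<dots> < \<mu> * \<rho> + \<epsilon>"
        using n \<delta>(2) by (simp add: distrib_left)
      finally show "nrm t < \<mu> * \<rho> + \<epsilon>" .
    qed
  qed

  have part2: "\<exists>M>0. \<exists>l>0. \<forall>\<rho>\<ge>0. \<forall>y \<in> integral_ineq_class r E K1 K2 \<rho>.
      bounded (y ` {-r..}) \<longrightarrow>
      (\<forall>t\<ge>0. sup_norm r (lift y t)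
        \<le> M * sup_norm r (lift y 0) * exp (- l * t) + (\<mu> + 1) / (1 - \<kappa> * c) * \<rho>)"
    if "\<kappa> < 1 / (1 + \<theta>)"
  proof -
    have k\<theta>: "\<kappa> * (1 + \<theta>) < 1" using that \<open>0 < \<theta>\<close> by (simp add: field_simps)
    have \<kappa>1: "\<kappa> < 1" using k\<theta> \<open>0 < \<theta>\<close> \<open>0 < \<kappa>\<close> by (smt (verit) mult_le_cancel_left1)
    have \<mu>: "0 < \<mu>" using \<kappa>1 by (simp add: \<mu>_def)
    \<comment> \<open>If \<open>c\<close> is not 1, the claim reads
      \<open>\<kappa> * \<theta> < 1 - \<kappa>\<close>, which is the hypothesis on
      \<open>\<kappa>\<close> rearranged.\<close>
    have \<kappa>c: "\<kappa> * c < 1"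
    proof (cases "\<theta> / (1 - \<kappa>) \<le> 1")
      case False
      then have "\<kappa> * c = \<kappa> * \<theta> / (1 - \<kappa>)" by (simp add: c_def)
      also have "\<dots> < 1" using k\<theta> \<kappa>1 by (simp add: field_simps)
      finally show ?thesis .
    qed (use \<kappa>1 in \<open>simp add: c_def\<close>)
    \<comment> \<open>chosen so that \<open>\<mu> / (1 - q) = (\<mu> + 1) / (1 - \<kappa> c)\<close>\<close>
    define \<delta> where "\<delta> = (1 - \<kappa> * c) / (\<mu> + 1)"
    define q where "q = \<kappa> * c + \<delta>"
    have \<delta>: "0 < \<delta>" using \<mu> \<kappa>c by (simp add: \<delta>_def)
    \<comment> \<open>Only the fraction \<open>1 / (\<mu> + 1)\<close> of the gap
      \<open>1 - \<kappa> * c\<close> has been spent on \<open>\<delta>\<close>; the rest keeps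
      \<open>q\<close> below 1.\<close>
    have q1: "1 - q = (1 - \<kappa> * c) * \<mu> / (\<mu> + 1)"
      using \<mu> by (simp add: q_def \<delta>_def field_simps)
    have "0 < (1 - \<kappa> * c) * \<mu> / (\<mu> + 1)" using \<mu> \<kappa>c by simp
    then have q: "0 < q" "q < 1"
      using q1 \<delta> c1 \<open>0 < \<kappa>\<close> by (simp_all add: q_def add_pos_pos)
    have \<gamma>: "\<mu> * \<rho> / (1 - q) = (\<mu> + 1) / (1 - \<kappa> * c) * \<rho>" for \<rho>
      unfolding q1 using \<mu> \<kappa>c by simp
    obtain S where S: "1 \<le> S" "\<And>u s. S \<le> u \<Longrightarrow> 0 \<le> s \<Longrightarrow> E (u + s) s \<le> \<delta>"
      using E_small[OF \<delta>] by blast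
    define T where "T = S + r"
    have T: "0 < T" using S(1) assms(1) by (simp add: T_def)
    show ?thesis
    \<comment> \<open>The rate makes the exponential drop by the factor \<open>q\<close> per block
      of length \<open>T\<close>. In \<open>c / q\<close>, \<open>c\<close> comes from the a priori
      bound on the initial incomplete block and \<open>1 / q\<close> from rounding.\<close>
    proof (rule exI[of _ "c / q"], intro exI[of _ "- ln q / T"] conjI allI impI ballI)
      show "0 < c / q" using c1 q by simp
      show "0 < - ln q / T" using q T by (intro divide_pos_pos) auto
      fix \<rho> t :: real and y
      assume \<rho>: "0 \<le> \<rho>" and y: "y \<in> integral_ineq_class r E K1 K2 \<rho>" "bounded (y ` {-r..})" and t: "0 \<le> t"
      interpret bounded_solution r \<theta> \<kappa> \<rho> E y
        rewrites "bounded_solution.\<mu> \<kappa> = \<mu>" and "bounded_solution.c \<theta> \<kappa> = c"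
        using solution[OF \<kappa>1 \<rho> y]
        by (simp_all add: bounded_solution.\<mu>_def bounded_solution.c_def \<mu>_def c_def)
      define n where "n = nat \<lfloor>t / T\<rfloor>"
      have "real n \<le> t / T" using t T unfolding n_def by simp
      then have u: "0 \<le> t - real n * T" using T by (simp add: field_simps)
      have "nrm t = nrm ((t - real n * T) + real n * (S + r))" by (simp add: T_def)
      also have "\<dots> \<le> q ^ n * (c * nrm 0) + \<mu> * \<rho> / (1 - q)"
        using S \<delta> u q(2) unfolding q_def by (intro geometric_decay) auto
      also have "q ^ n * (c * nrm 0) \<le> exp (- (- ln q / T) * t) / q * (c * nrm 0)"
        using power_nat_floor_le[OF q T t] c1 nrm_nonneg[of 0]
        unfolding n_def by (intro mult_right_mono) auto
      finally show "nrm t \<le> c / q * nrm 0 * exp (- (- ln q / T) * t) + (\<mu> + 1) / (1 - \<kappa> * c) * \<rho>"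
        unfolding \<gamma> by (simp add: mult_ac)
    qed
  qed
  show ?thesis
    unfolding Let_def \<mu>_def[symmetric] c_def[symmetric]
    by (intro conjI impI allI part1 part2)
qed

end
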